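(* Let $n\ge 3$ and let $C_n$ be the cycle graph with vertex set $\{1,\dots,n\}$ and edges $\{i,i+1\}$, where indices are taken modulo $n$ (so $n+1=1$). Consider the scenario $\mathbb{B}_{LSSS}$ associated with $C_n$ (defined in the context), with error parameters $\varepsilon_1,\dots,\varepsilon_n\ge 0$, and write $r_{i\,i+1}:=p(0\mid M_i,P_{i+1})$ for $i=1,\dots,n$ (so $r_{n1}=p(0\mid M_n,P_1)$). If the statistics of the scenario are explained by a preparation noncontextual ontological model, then $$ r_{12}+r_{23}+\dots+r_{(n-1)n}-r_{n1}\;\le\; n-2+\varepsilon_1+\varepsilon_2+\dots+\varepsilon_n, $$ and the same holds for every other position of the minus sign, i.e. for every $j\in\{1,\dots,n\}$, $$ -\,r_{j\,j+1}+\sum_{i\ne j} r_{i\,i+1}\;\le\; n-2+\sum_{i=1}^n\varepsilon_i . $$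
   Context: Scenario $\mathbb{B}_{LSSS}$ for a graph $G=(V,E)$. It is a finite prepare-and-measure scenario with: (1) for each vertex $v\in V$, a preparation $P_v$ and a binary-outcome measurement $M_v$ with outcomes $\{0,1\}$; (2) for each edge $e=\{v,w\}\in E$, two further preparations $P^e_{v^\perp}$ and $P^e_{w^\perp}$; (3) for each edge $e=\{v,w\}$, the operational equivalence $\tfrac12P_v+\tfrac12P^e_{v^\perp}\simeq\tfrac12P_w+\tfrac12P^e_{w^\perp}$ between the two equal-weight probabilistic mixtures of preparations; (4) for each vertex $v$, a real number $\varepsilon_v\ge0$ such that $p(0\mid M_v,P_v)\ge 1-\varepsilon_v$ and $p(0\mid M_v,P^e_{v^\perp})\le\varepsilon_v$ for every edge $e$ containing $v$. Here $p(k\mid M,P)$ is the probability of outcome $k$ when preparation $P$ is followed by measurement $M$. Ontological model. It consists of a measure space $\Lambda$ (with reference measure $d\lambda$), a probability density $\mu_P\ge0$, $\int_\Lambda\mu_P(\lambda)\,d\lambda=1$, for each preparation $P$, and measurable response functions $\xi(k\mid M,\lambda)\ge0$ with $\sum_k\xi(k\mid M,\lambda)=1$ for each measurement $M$ and $\lambda\in\Lambda$. It explains the statistics if $p(k\mid M,P)=\int_\Lambda\xi(k\mid M,\lambda)\mu_P(\lambda)\,d\lambda$ for all $k,M,P$. A probabilistic mixture $\tfrac12P+\tfrac12P'$ of preparations is represented by the density $\tfrac12\mu_P+\tfrac12\mu_{P'}$. Preparation noncontextuality. Operationally equivalent preparations (including mixtures) are represented by the same density: $P\simeq P'$ implies $\mu_P=\mu_{P'}$.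 Thus in the scenario above, for each edge $e=\{v,w\}$, $\tfrac12\mu_{P_v}+\tfrac12\mu_{P^e_{v^\perp}}=\tfrac12\mu_{P_w}+\tfrac12\mu_{P^e_{w^\perp}}$. *)

theory Defs
  imports "HOL-Probability.Probability"
begin

section \<open>Prepare-and-measure scenarios with binary outcomes\<close>

text \<open>Outcomes are the natural numbers 0 and 1. Statistics are written \<open>p k M P\<close> for the
  probability of outcome \<open>k\<close> when preparation \<open>P\<close> is followed by measurement \<open>M\<close>. A probabilistic
  mixture of (finitely many) preparations is a finitely supported \<open>pmf\<close> on preparations. The
  operational equivalences are part of the data of a scenario.\<close>

record ('p, 'm) pm_scenario =
  preparations :: "'p set"
  measurements :: "'m set"
  equivalences :: "('p pmf \<times> 'p pmf) set"

definition mix :: "'p pmf \<Rightarrow> ('p \<Rightarrow> real) \<Rightarrow> real" where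
  "mix q f = measure_pmf.expectation q f"

definition scenario_statistics ::
    "('p, 'm) pm_scenario \<Rightarrow> (nat \<Rightarrow> 'm \<Rightarrow> 'p \<Rightarrow> real) \<Rightarrow> bool" where
  "scenario_statistics S p \<longleftrightarrow>
     (\<forall>M\<in>measurements S. \<forall>P\<in>preparations S.
        (\<forall>k\<in>{0, 1}. p k M P \<ge> 0) \<and> (\<Sum>k\<in>{0, 1}. p k M P) = 1) \<and>
     (\<forall>(q, q')\<in>equivalences S. \<forall>M\<in>measurements S. \<forall>k\<in>{0, 1}.
        mix q (p k M) = mix q' (p k M))"

section \<open>Ontological models\<close>

locale ontological_model =
  fixes S :: "('p, 'm) pm_scenario"
    and \<Lambda> :: "'l measure"
    and \<mu> :: "'p \<Rightarrow> 'l \<Rightarrow> real"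
    and \<xi> :: "nat \<Rightarrow> 'm \<Rightarrow> 'l \<Rightarrow> real"
  assumes density_nonneg:
      "\<And>P l. P \<in> preparations S \<Longrightarrow> l \<in> space \<Lambda> \<Longrightarrow> \<mu> P l \<ge> 0"
    and density_integral:
      "\<And>P. P \<in> preparations S \<Longrightarrow> has_bochner_integral \<Lambda> (\<mu> P) 1"
    and response_measurable:
      "\<And>k M. k \<in> {0, 1} \<Longrightarrow> M \<in> measurements S \<Longrightarrow> \<xi> k M \<in> borel_measurable \<Lambda>"
    and response_nonneg:
      "\<And>k M l. k \<in> {0, 1} \<Longrightarrow> M \<in> measurements S \<Longrightarrow> l \<in> space \<Lambda> \<Longrightarrow> \<xi> k M l \<ge> 0"
    and response_sum:
      "\<And>M l. M \<in> measurements S \<Longrightarrow> l \<in> space \<Lambda> \<Longrightarrow> (\<Sum>k\<in>{0, 1}. \<xi> k M l) = 1"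

definition explains ::
    "('p, 'm) pm_scenario \<Rightarrow> 'l measure \<Rightarrow> ('p \<Rightarrow> 'l \<Rightarrow> real) \<Rightarrow> (nat \<Rightarrow> 'm \<Rightarrow> 'l \<Rightarrow> real) \<Rightarrow>
      (nat \<Rightarrow> 'm \<Rightarrow> 'p \<Rightarrow> real) \<Rightarrow> bool" where
  "explains S \<Lambda> \<mu> \<xi> p \<longleftrightarrow>
     (\<forall>k\<in>{0, 1}. \<forall>M\<in>measurements S. \<forall>P\<in>preparations S.
        p k M P = (LINT l|\<Lambda>. \<xi> k M l * \<mu> P l))"

text \<open>Densities are identified when they agree almost everywhere with respect to the reference
  measure.\<close>

definition preparation_noncontextual ::
    "('p, 'm) pm_scenario \<Rightarrow> 'l measure \<Rightarrow> ('p \<Rightarrow> 'l \<Rightarrow> real) \<Rightarrow> bool" where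
  "preparation_noncontextual S \<Lambda> \<mu> \<longleftrightarrow>
     (\<forall>(q, q')\<in>equivalences S. AE l in \<Lambda>. mix q (\<lambda>P. \<mu> P l) = mix q' (\<lambda>P. \<mu> P l))"

section \<open>The scenario of a graph\<close>

definition simple_graph :: "'v set \<Rightarrow> 'v set set \<Rightarrow> bool" where
  "simple_graph V E \<longleftrightarrow> finite V \<and> (\<forall>e\<in>E. e \<subseteq> V \<and> card e = 2)"

text \<open>\<open>Prep v\<close> is $P_v$ and \<open>Perp e v\<close> is $P^e_{v^\perp}$; only the instances with \<open>v \<in> e \<in> E\<close>
  belong to the scenario. The measurement $M_v$ is labelled by \<open>v\<close> itself.\<close>

datatype 'v prep = Prep 'v | Perp "'v set" 'v

definition lsss :: "'v set \<Rightarrow> 'v set set \<Rightarrow> ('v prep, 'v) pm_scenario" where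
  "lsss V E =
     \<lparr> preparations = Prep ` V \<union> {Perp e v | e v. e \<in> E \<and> v \<in> e},
       measurements = V,
       equivalences =
         {(pmf_of_set {Prep v, Perp e v}, pmf_of_set {Prep w, Perp e w}) | e v w.
            e \<in> E \<and> e = {v, w}} \<rparr>"

definition lsss_statistics ::
    "'v set \<Rightarrow> 'v set set \<Rightarrow> ('v \<Rightarrow> real) \<Rightarrow> (nat \<Rightarrow> 'v \<Rightarrow> 'v prep \<Rightarrow> real) \<Rightarrow> bool" where
  "lsss_statistics V E \<epsilon> p \<longleftrightarrow>
     scenario_statistics (lsss V E) p \<and>
     (\<forall>v\<in>V. \<epsilon> v \<ge> 0 \<and> p 0 v (Prep v) \<ge> 1 - \<epsilon> v \<and>
        (\<forall>e\<in>E. v \<in> e \<longrightarrow> p 0 v (Perp e v) \<le> \<epsilon> v))"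

lemma mix_half:
  assumes "P \<noteq> P'"
  shows "mix (pmf_of_set {P, P'}) f = 1/2 * f P + 1/2 * f P'"
  using assms by (simp add: mix_def integral_pmf_of_set add_divide_distrib)

lemma lsss_noncontextual_iff:
  "preparation_noncontextual (lsss V E) \<Lambda> \<mu> \<longleftrightarrow>
     (\<forall>v w. {v, w} \<in> E \<longrightarrow>
        (AE l in \<Lambda>. 1/2 * \<mu> (Prep v) l + 1/2 * \<mu> (Perp {v, w} v) l =
                   1/2 * \<mu> (Prep w) l + 1/2 * \<mu> (Perp {v, w} w) l))"
  unfolding preparation_noncontextual_def lsss_def by (fastforce simp: mix_half)

section \<open>The cycle graph\<close>

definition cycle_vertices :: "nat \<Rightarrow> nat set" where
  "cycle_vertices n = {1..n}"

definition cycle_succ :: "nat \<Rightarrow> nat \<Rightarrow> nat" where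
  "cycle_succ n i = (if i = n then 1 else i + 1)"

definition cycle_edges :: "nat \<Rightarrow> nat set set" where
  "cycle_edges n = {{i, cycle_succ n i} | i. i \<in> {1..n}}"

lemma simple_graph_cycle:
  assumes "n \<ge> 3"
  shows "simple_graph (cycle_vertices n) (cycle_edges n)"
  using assms
  by (auto simp: simple_graph_def cycle_vertices_def cycle_edges_def cycle_succ_def card_insert_if)

end

theory Submission
  imports Defs
begin

text \<open>Write \<open>a\<^sub>i\<close> for the response function of outcome 0 of \<open>M\<^sub>i\<close>, and \<open>d\<^sub>i\<close> for the total variation
  distance between the densities \<open>\<mu>\<^sub>i\<close> and \<open>\<mu>\<^sub>i\<^sub>+\<^sub>1\<close> of \<open>P\<^sub>i\<close> and \<open>P\<^sub>i\<^sub>+\<^sub>1\<close>. By noncontextuality the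
  positive part of \<open>\<mu>\<^sub>i\<^sub>+\<^sub>1 - \<mu>\<^sub>i\<close> lies below the density of the preparation orthogonal to \<open>P\<^sub>i\<close>, on
  which \<open>a\<^sub>i\<close> has integral at most \<open>\<epsilon>\<^sub>i\<close>; hence \<open>r\<^sub>i \<le> 1 - d\<^sub>i + \<epsilon>\<^sub>i\<close>. Conversely
  \<open>r\<^sub>j \<ge> 1 - \<epsilon>\<^sub>j - d\<^sub>j\<close>, because the integrals of \<open>a\<^sub>j\<close> against two densities differ by at most their
  total variation distance. The triangle inequality \<open>d\<^sub>j \<le> (\<Sum>i\<noteq>j. d\<^sub>i)\<close> around the cycle
  concludes.\<close>

lemma integrable_mult_unit_interval:
  fixes a f :: "'a \<Rightarrow> real"
  assumes "integrable M f" "a \<in> borel_measurable M"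
    and "\<And>x. x \<in> space M \<Longrightarrow> 0 \<le> a x \<and> a x \<le> 1"
  shows "integrable M (\<lambda>x. a x * f x)"
proof (rule Bochner_Integration.integrable_bound[OF assms(1)])
  show "(\<lambda>x. a x * f x) \<in> borel_measurable M"
    using assms(1,2) by measurable
  show "AE x in M. norm (a x * f x) \<le> norm (f x)"
    using assms(3) by (auto intro!: AE_I2 mult_left_le_one_le simp: abs_mult)
qed

text \<open>The term \<open>(f x + g x - \<bar>f x - g x\<bar>) / 2\<close> is min(f, g). Split g
  into min(f, g) and the positive part of g - f. On the first summand use a \<le> 1; the second is
  at most f', since g - f = f' - g' and g' \<ge> 0.\<close>

lemma integral_unit_interval_le_overlap:
  fixes a f g f' g' :: "'a \<Rightarrow> real"
  assumes int: "integrable M f" "integrable M g" "integrable M f'"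
    and a: "a \<in> borel_measurable M" "\<And>x. x \<in> space M \<Longrightarrow> 0 \<le> a x \<and> a x \<le> 1"
    and nonneg: "\<And>x. x \<in> space M \<Longrightarrow> 0 \<le> f x \<and> 0 \<le> g x \<and> 0 \<le> f' x \<and> 0 \<le> g' x"
    and eq: "AE x in M. f x + f' x = g x + g' x"
  shows "(LINT x|M. a x * g x)
    \<le> (integral\<^sup>L M f + integral\<^sup>L M g - (LINT x|M. \<bar>f x - g x\<bar>)) / 2 + (LINT x|M. a x * f' x)"
proof -
  have "AE x in M. a x * g x \<le> (f x + g x - \<bar>f x - g x\<bar>) / 2 + a x * f' x"
    using eq AE_space
  proof eventually_elim
    case (elim x)
    note a' = a(2)[OF elim(2)] and nn = nonneg[OF elim(2)]
    show ?case
    proof (cases "g x \<le> f x")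
      case True
      have "a x * g x \<le> g x" "0 \<le> a x * f' x"
        using a' nn by (auto intro: mult_left_le_one_le)
      with True show ?thesis by (simp add: field_simps)
    next
      case False
      \<comment> \<open>Here min(f, g) = f, so a g is split as a f + a (g - f).\<close>
      have "a x * (g x - f x) \<le> a x * f' x" "a x * f x \<le> f x"
        using a' nn elim(1) by (auto intro: mult_left_mono mult_left_le_one_le)
      with False show ?thesis by (simp add: field_simps)
    qed
  qed
  then have "(LINT x|M. a x * g x) \<le> (LINT x|M. (f x + g x - \<bar>f x - g x\<bar>) / 2 + a x * f' x)"
    using int a by (intro integral_mono_AE) (auto intro!: integrable_mult_unit_interval)
  also have "\<dots> = (integral\<^sup>L M f + integral\<^sup>L M g - (LINT x|M. \<bar>f x - g x\<bar>)) / 2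
      + (LINT x|M. a x * f' x)"
    using int integrable_mult_unit_interval[OF int(3) a] by simp
  finally show ?thesis .
qed

text \<open>Pointwise, a (f - g) is at most the positive part of f - g, which is
  \<open>(f x - g x + \<bar>f x - g x\<bar>) / 2\<close>.\<close>

lemma integral_unit_interval_diff_le:
  fixes a f g :: "'a \<Rightarrow> real"
  assumes int: "integrable M f" "integrable M g"
    and a: "a \<in> borel_measurable M" "\<And>x. x \<in> space M \<Longrightarrow> 0 \<le> a x \<and> a x \<le> 1"
  shows "(LINT x|M. a x * f x) - (LINT x|M. a x * g x)
    \<le> (integral\<^sup>L M f - integral\<^sup>L M g + (LINT x|M. \<bar>f x - g x\<bar>)) / 2"
proof -
  note af = integrable_mult_unit_interval[OF int(1) a]
    and ag = integrable_mult_unit_interval[OF int(2) a]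
  have "(LINT x|M. a x * f x) - (LINT x|M. a x * g x) = (LINT x|M. a x * f x - a x * g x)"
    using af ag by simp
  also have "\<dots> \<le> (LINT x|M. (f x - g x + \<bar>f x - g x\<bar>) / 2)"
  proof (rule integral_mono)
    fix x assume "x \<in> space M"
    then have a': "0 \<le> a x" "a x \<le> 1" using a(2) by auto
    show "a x * f x - a x * g x \<le> (f x - g x + \<bar>f x - g x\<bar>) / 2"
    proof (cases "g x \<le> f x")
      case True
      then have "a x * (f x - g x) \<le> f x - g x" using a' by (intro mult_left_le_one_le) auto
      with True show ?thesis by (simp add: right_diff_distrib)
    next
      case False
      then have "a x * (f x - g x) \<le> 0" using a' by (intro mult_nonneg_nonpos) auto
      with False show ?thesis by (simp add: right_diff_distrib)
    qed
  qed (use int af ag in auto)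
  also have "\<dots> = (integral\<^sup>L M f - integral\<^sup>L M g + (LINT x|M. \<bar>f x - g x\<bar>)) / 2"
    using int by simp
  finally show ?thesis .
qed

lemma bij_betw_cycle_succ: "bij_betw (cycle_succ n) {1..n} {1..n}"
proof -
  have "inj_on (cycle_succ n) {1..n}"
    by (auto simp: inj_on_def cycle_succ_def split: if_splits)
  moreover have "cycle_succ n ` {1..n} \<subseteq> {1..n}"
    by (auto simp: cycle_succ_def)
  ultimately show ?thesis
    by (simp add: bij_betw_def endo_inj_surj)
qed

text \<open>Since \<open>cycle_succ n\<close> permutes the vertices, the differences around the
  cycle sum to zero, so each one is minus the sum of the others.\<close>

lemma abs_diff_cycle_succ_le:
  fixes x :: "nat \<Rightarrow> real"
  assumes "j \<in> {1..n}"
  shows "\<bar>x j - x (cycle_succ n j)\<bar> \<le> (\<Sum>i\<in>{1..n} - {j}. \<bar>x i - x (cycle_succ n i)\<bar>)"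
proof -
  have "(\<Sum>i=1..n. x i - x (cycle_succ n i)) = 0"
    using sum.reindex_bij_betw[OF bij_betw_cycle_succ, of x n] by (simp add: sum_subtractf)
  then have "x j - x (cycle_succ n j) = - (\<Sum>i\<in>{1..n} - {j}. x i - x (cycle_succ n i))"
    using sum.remove[OF _ assms, of "\<lambda>i. x i - x (cycle_succ n i)"] by simp
  then show ?thesis
    using sum_abs[of "\<lambda>i. x i - x (cycle_succ n i)" "{1..n} - {j}"] by simp
qed

theorem corollary1:
  fixes n :: nat
    and \<epsilon> :: "nat \<Rightarrow> real"
    and p :: "nat \<Rightarrow> nat \<Rightarrow> nat prep \<Rightarrow> real"
    and r :: "nat \<Rightarrow> real"
    and \<Lambda> :: "'l measure"
    and \<mu> :: "nat prep \<Rightarrow> 'l \<Rightarrow> real"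
    and \<xi> :: "nat \<Rightarrow> nat \<Rightarrow> 'l \<Rightarrow> real"
  assumes "n \<ge> 3"
    and "lsss_statistics (cycle_vertices n) (cycle_edges n) \<epsilon> p"
    and "\<And>i. i \<in> {1..n} \<Longrightarrow> r i = p 0 i (Prep (cycle_succ n i))"
    and "ontological_model (lsss (cycle_vertices n) (cycle_edges n)) \<Lambda> \<mu> \<xi>"
    and "explains (lsss (cycle_vertices n) (cycle_edges n)) \<Lambda> \<mu> \<xi> p"
    and "preparation_noncontextual (lsss (cycle_vertices n) (cycle_edges n)) \<Lambda> \<mu>"
  shows "(\<Sum>i=1..n-1. r i) - r n \<le> real n - 2 + (\<Sum>i=1..n. \<epsilon> i) \<and>
         (\<forall>j\<in>{1..n}. - r j + (\<Sum>i\<in>{1..n} - {j}. r i) \<le> real n - 2 + (\<Sum>i=1..n. \<epsilon> i))"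
proof -
  let ?S = "lsss (cycle_vertices n) (cycle_edges n)"
  interpret ontological_model ?S \<Lambda> \<mu> \<xi> by fact
  define s where "s = cycle_succ n"
  define m where "m i = \<mu> (Prep i)" for i
  define d where "d i = (LINT l|\<Lambda>. \<bar>m i l - m (s i) l\<bar>) / 2" for i
  have s: "s i \<in> {1..n}" if "i \<in> {1..n}" for i
    using that bij_betw_cycle_succ[of n] unfolding s_def by (auto dest: bij_betwE)
  have edge: "{i, s i} \<in> cycle_edges n" if "i \<in> {1..n}" for i
    using that by (auto simp: cycle_edges_def s_def)
  have meas: "i \<in> measurements ?S" and prep: "Prep i \<in> preparations ?S" if "i \<in> {1..n}" for i
    using that by (auto simp: lsss_def cycle_vertices_def)
  have perp: "Perp {i, s i} i \<in> preparations ?S" "Perp {i, s i} (s i) \<in> preparations ?S"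
    if "i \<in> {1..n}" for i
    using edge[OF that] by (auto simp: lsss_def)
  have int: "integrable \<Lambda> (\<mu> P)" "integral\<^sup>L \<Lambda> (\<mu> P) = 1" if "P \<in> preparations ?S" for P
    using density_integral[OF that] by (auto simp: has_bochner_integral_iff)
  have p: "p 0 i P = (LINT l|\<Lambda>. \<xi> 0 i l * \<mu> P l)" if "i \<in> {1..n}" "P \<in> preparations ?S" for i P
    using assms(5) that meas by (simp add: explains_def)
  have \<xi>: "\<xi> 0 i \<in> borel_measurable \<Lambda>" "\<And>l. l \<in> space \<Lambda> \<Longrightarrow> 0 \<le> \<xi> 0 i l \<and> \<xi> 0 i l \<le> 1"
    if "i \<in> {1..n}" for i
  proof -
    show "\<xi> 0 i \<in> borel_measurable \<Lambda>" using response_measurable meas[OF that] by simp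
    fix l assume l: "l \<in> space \<Lambda>"
    show "0 \<le> \<xi> 0 i l \<and> \<xi> 0 i l \<le> 1"
      using response_nonneg[OF _ meas[OF that] l, of 0] response_nonneg[OF _ meas[OF that] l, of 1]
        response_sum[OF meas[OF that] l] by simp
  qed
  have eps: "1 - \<epsilon> i \<le> p 0 i (Prep i)" "p 0 i (Perp {i, s i} i) \<le> \<epsilon> i" if "i \<in> {1..n}" for i
    using assms(2) that edge[OF that] by (auto simp: lsss_statistics_def cycle_vertices_def)
  have r: "r i = (LINT l|\<Lambda>. \<xi> 0 i l * m (s i) l)" if "i \<in> {1..n}" for i
    using assms(3) that p prep s by (simp add: s_def m_def)
  have upper: "r i \<le> 1 - d i + \<epsilon> i" if i: "i \<in> {1..n}" for i
  proof -
    \<comment> \<open>This is noncontextuality for the edge {i, s i}, with the mixture weights 1/2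
      cleared.\<close>
    have "AE l in \<Lambda>. m i l + \<mu> (Perp {i, s i} i) l = m (s i) l + \<mu> (Perp {i, s i} (s i)) l"
      using assms(6)[unfolded lsss_noncontextual_iff, rule_format, OF edge[OF i]]
      by eventually_elim (simp add: m_def)
    then have "(LINT l|\<Lambda>. \<xi> 0 i l * m (s i) l)
        \<le> (integral\<^sup>L \<Lambda> (m i) + integral\<^sup>L \<Lambda> (m (s i)) - (LINT l|\<Lambda>. \<bar>m i l - m (s i) l\<bar>)) / 2
          + (LINT l|\<Lambda>. \<xi> 0 i l * \<mu> (Perp {i, s i} i) l)"
      using int prep[OF i] prep[OF s[OF i]] perp[OF i] \<xi>[OF i] density_nonneg
      by (intro integral_unit_interval_le_overlap) (auto simp: m_def)
    \<comment> \<open>Both densities have mass 1, so the overlap term is (1 + 1 - 2 d i) / 2 = 1 - d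
      i.\<close>
    then show ?thesis
      using eps(2)[OF i] p[OF i perp(1)[OF i]] r[OF i]
        int(2)[OF prep[OF i]] int(2)[OF prep[OF s[OF i]]]
      by (simp add: d_def m_def diff_divide_distrib)
  qed
  have lower: "1 - \<epsilon> i - d i \<le> r i" if i: "i \<in> {1..n}" for i
    using integral_unit_interval_diff_le[OF int(1)[OF prep[OF i]] int(1)[OF prep[OF s[OF i]]] \<xi>[OF i]]
      eps(1)[OF i] p[OF i prep[OF i]] r[OF i]
      int(2)[OF prep[OF i]] int(2)[OF prep[OF s[OF i]]]
    by (simp add: d_def m_def diff_divide_distrib)
  have triangle: "d j \<le> (\<Sum>i\<in>{1..n} - {j}. d i)" if j: "j \<in> {1..n}" for j
  proof -
    have diff: "integrable \<Lambda> (\<lambda>l. \<bar>m i l - m (s i) l\<bar>)" if "i \<in> {1..n}" for i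
      using int(1)[OF prep[OF that]] int(1)[OF prep[OF s[OF that]]] by (simp add: m_def)
    \<comment> \<open>The cycle inequality is applied at each fixed l to the numbers
      \<open>m i l\<close>, then integrated.\<close>
    have "(LINT l|\<Lambda>. \<bar>m j l - m (s j) l\<bar>)
        \<le> (LINT l|\<Lambda>. (\<Sum>i\<in>{1..n} - {j}. \<bar>m i l - m (s i) l\<bar>))"
      using diff j abs_diff_cycle_succ_le[OF j] unfolding s_def
      by (intro integral_mono) auto
    also have "\<dots> = (\<Sum>i\<in>{1..n} - {j}. LINT l|\<Lambda>. \<bar>m i l - m (s i) l\<bar>)"
      using diff by (intro Bochner_Integration.integral_sum) auto
    finally show ?thesis
      by (simp add: d_def flip: sum_divide_distrib)
  qed
  have main: "- r j + (\<Sum>i\<in>{1..n} - {j}. r i) \<le> real n - 2 + (\<Sum>i=1..n. \<epsilon> i)"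
    if j: "j \<in> {1..n}" for j
  proof -
    \<comment> \<open>The n - 1 upper bounds contribute n - 1 and the lower bound on r j contributes
      -1, giving n - 2. The remaining d j minus the sum of the other d i is at most 0 by
      \<open>triangle\<close>.\<close>
    have "(\<Sum>i\<in>{1..n} - {j}. r i) \<le> (\<Sum>i\<in>{1..n} - {j}. 1 - d i + \<epsilon> i)"
      using upper by (intro sum_mono) auto
    also have "\<dots> = real n - 1 - (\<Sum>i\<in>{1..n} - {j}. d i) + (\<Sum>i\<in>{1..n} - {j}. \<epsilon> i)"
      using j by (simp add: sum.distrib sum_subtractf of_nat_diff)
    finally show ?thesis
      using lower[OF j] triangle[OF j] sum.remove[OF _ j, of \<epsilon>] by simp
  qed
  \<comment> \<open>The first inequality is the case j = n of the second.\<close>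
  have "{1..n} - {n} = {1..n-1}" by auto
  then show ?thesis
    using main main[of n] assms(1) by auto
qed

end
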